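(* Let $\Gamma=(V,E)$ be a finite connected regular graph and write $|V|=m+1$. Then there exists a filtration $$\{pt\}=\Gamma_0\subset\Gamma_1\subset\cdots\subset\Gamma_m=\Gamma$$ of $\Gamma$, in the sense of the definition of filtration of a connected regular graph given in the context.
   Context: A graph is a pair $(V,E)$ with $V$ a non-empty set of vertices and $E$ a non-empty set of edges, each edge $e=(x,y)$ joining two distinct vertices $x\ne y$ of $V$ (which are then called adjacent). For an edge $e$, $V(e)$ denotes the set of its two end vertices. A graph is regular of degree $n$ if every vertex is incident to exactly $n$ edges. A filtration of a connected regular graph $\Gamma=(V,E)$ with $|V|=m+1$ is a sequence of graphs $\Gamma_k=(V_k,E_k)$, $k=0,\dots,m$, coming from an ordering $b_0,b_1,\dots,b_m$ of all the vertices of $\Gamma$, such that: (i) $V_k=\{b_0,\dots,b_k\}$ and $E_k=\{e\in E \mid V(e)\subset V_k\}$ (so $E_0=\emptyset$ and $\Gamma_0$ is one vertex); (ii) for every $0\le k<m$, if $k':=\min\{\ell\in\{0,\dots,k\} \mid b_\ell \text{ is adjacent to a vertex in } V\setminus V_k\}$, then $b_{k+1}\in V\setminus V_k$ is adjacent to $b_{k'}$; (iii) $\Gamma_m=\Gamma$. *)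

theory Defs imports Main begin

text \<open>An undirected edge joining \<open>x\<close> and \<open>y\<close> is the set \<open>{x, y}\<close>, so the set \<open>V(e)\<close> of end
  vertices of an edge \<open>e\<close> is \<open>e\<close> itself. The type carries no axioms, because the first member
  of a filtration has no edges and is therefore not a graph in the sense of \<open>is_graph\<close>.\<close>

datatype 'a sgraph = SGraph (verts: "'a set") (edges: "'a set set")

definition is_graph :: "'a sgraph \<Rightarrow> bool" where
  "is_graph G \<longleftrightarrow> verts G \<noteq> {} \<and> edges G \<noteq> {} \<and>
     (\<forall>e\<in>edges G. \<exists>x\<in>verts G. \<exists>y\<in>verts G. x \<noteq> y \<and> e = {x, y})"

definition adjacent :: "'a sgraph \<Rightarrow> 'a \<Rightarrow> 'a \<Rightarrow> bool" where
  "adjacent G x y \<longleftrightarrow> {x, y} \<in> edges G"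

definition regular_of_degree :: "'a sgraph \<Rightarrow> nat \<Rightarrow> bool" where
  "regular_of_degree G n \<longleftrightarrow>
     (\<forall>v\<in>verts G. finite {e \<in> edges G. v \<in> e} \<and> card {e \<in> edges G. v \<in> e} = n)"

definition regular_graph :: "'a sgraph \<Rightarrow> bool" where
  "regular_graph G \<longleftrightarrow> (\<exists>n. regular_of_degree G n)"

definition connected_graph :: "'a sgraph \<Rightarrow> bool" where
  "connected_graph G \<longleftrightarrow> (\<forall>x\<in>verts G. \<forall>y\<in>verts G. (adjacent G)\<^sup>*\<^sup>* x y)"

definition proper_subgraph :: "'a sgraph \<Rightarrow> 'a sgraph \<Rightarrow> bool" where
  "proper_subgraph H G \<longleftrightarrow> verts H \<subseteq> verts G \<and> edges H \<subseteq> edges G \<and> H \<noteq> G"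

text \<open>Only the values \<open>Gs 0, \<dots>, Gs m\<close> matter. The set whose minimum is taken is nonempty for
  every \<open>k < m\<close> when \<open>G\<close> is connected, which is the only case in which the notion is used.\<close>

definition is_filtration :: "'a sgraph \<Rightarrow> nat \<Rightarrow> (nat \<Rightarrow> 'a sgraph) \<Rightarrow> bool" where
  "is_filtration G m Gs \<longleftrightarrow> (\<exists>b. bij_betw b {0..m} (verts G) \<and>
     (\<forall>k\<le>m. verts (Gs k) = b ` {0..k} \<and>
             edges (Gs k) = {e \<in> edges G. e \<subseteq> verts (Gs k)}) \<and>
     (\<forall>k<m. let k' = Min {l \<in> {0..k}. \<exists>v \<in> verts G - verts (Gs k). adjacent G (b l) v}
             in b (k + 1) \<in> verts G - verts (Gs k) \<and> adjacent G (b (k + 1)) (b k')) \<and>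
     Gs m = G)"

end

theory Submission imports Defs begin

text \<open>The ordering is built greedily, as in a breadth-first search. Suppose that \<open>b 0, \<dots>, b k\<close>
  have been chosen and do not yet exhaust the vertices. Since the graph is connected, some chosen
  vertex has a neighbour that is not chosen (\<open>connected_graph_crossing_edge\<close>), so there is a least
  index \<open>k'\<close> for which \<open>b k'\<close> has such a neighbour, and any such neighbour may serve as
  \<open>b (k + 1)\<close>. The rule that \<open>b (k + 1)\<close> has to obey mentions only \<open>b 0, \<dots>, b (k + 1)\<close>, so later
  choices never spoil earlier ones (\<open>greedy_step_cong\<close>), and the process goes on until all
  \<open>m + 1\<close> vertices have been listed (\<open>greedy_prefix_exists\<close>). The induced subgraphs on the
  initial segments of this ordering form the filtration.\<close>

definition induced_subgraph :: "'a sgraph \<Rightarrow> 'a set \<Rightarrow> 'a sgraph" where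
  "induced_subgraph G S = SGraph S {e \<in> edges G. e \<subseteq> S}"

definition frontier_indices :: "'a sgraph \<Rightarrow> (nat \<Rightarrow> 'a) \<Rightarrow> nat \<Rightarrow> nat set" where
  "frontier_indices G b k =
     {l \<in> {0..k}. \<exists>v \<in> verts G - b ` {0..k}. adjacent G (b l) v}"

definition greedy_step :: "'a sgraph \<Rightarrow> (nat \<Rightarrow> 'a) \<Rightarrow> nat \<Rightarrow> bool" where
  "greedy_step G b k \<longleftrightarrow> b (k + 1) \<in> verts G - b ` {0..k} \<and>
     adjacent G (b (k + 1)) (b (Min (frontier_indices G b k)))"

lemma adjacent_commute: "adjacent G x y \<longleftrightarrow> adjacent G y x"
  by (simp add: adjacent_def insert_commute)

lemma is_graph_edge_subset: "is_graph G \<Longrightarrow> e \<in> edges G \<Longrightarrow> e \<subseteq> verts G"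
  by (auto simp: is_graph_def)

lemma induced_subgraph_verts: "is_graph G \<Longrightarrow> induced_subgraph G (verts G) = G"
  using is_graph_edge_subset[of G]
  by (cases G) (auto simp: induced_subgraph_def)

lemma induced_subgraph_singleton: "is_graph G \<Longrightarrow> induced_subgraph G {p} = SGraph {p} {}"
  by (fastforce simp: induced_subgraph_def is_graph_def)

lemma proper_subgraph_induced:
  "S \<subset> T \<Longrightarrow> proper_subgraph (induced_subgraph G S) (induced_subgraph G T)"
  by (auto simp: proper_subgraph_def induced_subgraph_def)

text \<open>A path from \<open>S\<close> to a vertex outside \<open>S\<close> has a first edge that leaves \<open>S\<close>.\<close>

lemma connected_graph_crossing_edge:
  assumes "is_graph G" "connected_graph G" "S \<subseteq> verts G" "S \<noteq> {}" "S \<noteq> verts G"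
  obtains x y where "x \<in> S" "y \<in> verts G - S" "adjacent G x y"
proof -
  obtain s t where s: "s \<in> S" and t: "t \<in> verts G - S"
    using assms(3-5) by blast
  have "(adjacent G)\<^sup>*\<^sup>* s t"
    using assms(2,3) s t by (auto simp: connected_graph_def)
  then have "t \<in> S \<or> (\<exists>x\<in>S. \<exists>y\<in>verts G - S. adjacent G x y)"
  proof (induction rule: rtranclp_induct)
    case base
    show ?case using s by simp
  next
    case (step y z)
    have "z \<in> verts G"
      using step.hyps(2) is_graph_edge_subset[OF assms(1)] by (auto simp: adjacent_def)
    then show ?case using step by blast
  qed
  then show thesis using t that by blast
qed

lemma greedy_step_cong:
  assumes eq: "\<And>i. i \<le> k + 1 \<Longrightarrow> b i = c i"
    and ne: "frontier_indices G b k \<noteq> {}"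
  shows "greedy_step G b k \<longleftrightarrow> greedy_step G c k"
proof -
  have img: "b ` {0..k} = c ` {0..k}"
    using eq by (intro image_cong) auto
  then have fr: "frontier_indices G b k = frontier_indices G c k"
    using eq by (auto simp: frontier_indices_def)
  \<comment> \<open>Without a frontier index the minimum is an unspecified number, at which \<open>b\<close> and \<open>c\<close> might
    differ.\<close>
  have "Min (frontier_indices G b k) \<in> frontier_indices G b k"
    using ne by (intro Min_in) (auto simp: frontier_indices_def)
  then have "Min (frontier_indices G b k) \<le> k"
    by (simp add: frontier_indices_def)
  then show ?thesis
    using eq img fr by (simp add: greedy_step_def)
qed

lemma frontier_indices_nonempty:
  assumes "is_graph G" "connected_graph G" "b ` {0..k} \<subset> verts G"
  shows "frontier_indices G b k \<noteq> {}"
proof -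
  obtain x y where "x \<in> b ` {0..k}" "y \<in> verts G - b ` {0..k}" "adjacent G x y"
  proof (rule connected_graph_crossing_edge[OF assms(1,2)])
    show "b ` {0..k} \<subseteq> verts G" "b ` {0..k} \<noteq> {}" "b ` {0..k} \<noteq> verts G"
      using assms(3) by auto
  qed
  then show ?thesis by (auto simp: frontier_indices_def)
qed

text \<open>As long as \<open>k < m\<close>, the \<open>k + 1\<close> vertices listed so far cannot be all of the \<open>m + 1\<close>
  vertices, so the list can be extended by a neighbour of the first frontier vertex.\<close>

lemma greedy_prefix_exists:
  assumes G: "is_graph G" "connected_graph G"
    and card: "card (verts G) = m + 1" and "k \<le> m"
  shows "\<exists>b. inj_on b {0..k} \<and> b ` {0..k} \<subseteq> verts G \<and> (\<forall>j<k. greedy_step G b j)"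
  using \<open>k \<le> m\<close>
proof (induction k)
  case 0
  obtain p where "p \<in> verts G" using G(1) by (auto simp: is_graph_def)
  then show ?case by (intro exI[of _ "\<lambda>_. p"]) auto
next
  case (Suc k)
  then obtain b where inj: "inj_on b {0..k}" and sub: "b ` {0..k} \<subseteq> verts G"
    and steps: "\<forall>j<k. greedy_step G b j"
    by auto
  have "card (b ` {0..k}) = k + 1"
    using inj by (simp add: card_image)
  then have psub: "b ` {0..k} \<subset> verts G"
    using sub card Suc.prems by auto
  let ?F = "frontier_indices G b"
  have ne: "?F j \<noteq> {}" if "j \<le> k" for j
  proof -
    have "b ` {0..j} \<subseteq> b ` {0..k}" using that by auto
    then show ?thesis using psub by (intro frontier_indices_nonempty G) blast
  qed
  have "Min (?F k) \<in> ?F k"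
    using ne[of k] by (intro Min_in) (auto simp: frontier_indices_def)
  then obtain v where min: "Min (?F k) \<le> k" and v: "v \<in> verts G - b ` {0..k}"
    and adj: "adjacent G (b (Min (?F k))) v"
    by (auto simp: frontier_indices_def)
  define c where "c = b(k + 1 := v)"
  have eq: "c i = b i" if "i \<le> k" for i
    using that by (simp add: c_def)
  have img: "c ` {0..k} = b ` {0..k}"
    using eq by (intro image_cong) auto
  have fr: "frontier_indices G c k = ?F k"
    using eq img by (auto simp: frontier_indices_def)
  have new: "greedy_step G c k"
    using min v adj eq img fr by (simp add: greedy_step_def c_def adjacent_commute)
  have old: "greedy_step G c j" if "j < k" for j
    using greedy_step_cong[of j b c G] ne[of j] steps eq that by simp
  have seg: "{0..Suc k} = insert (Suc k) {0..k}" by auto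
  have "inj_on c {0..k}"
    using inj eq by (simp add: inj_on_def)
  then have "inj_on c {0..Suc k}"
    using v img unfolding seg by (auto simp: c_def)
  moreover have "c ` {0..Suc k} \<subseteq> verts G"
    using sub v img unfolding seg by (auto simp: c_def)
  moreover have "\<forall>j<Suc k. greedy_step G c j"
    using old new by (auto simp: less_Suc_eq)
  ultimately show ?case by blast
qed

theorem proposition2p1:
  fixes G :: "'a sgraph" and m :: nat
  assumes "is_graph G"
    and "finite (verts G)"
    and "connected_graph G"
    and "regular_graph G"
    and "card (verts G) = m + 1"
  shows "\<exists>Gs. is_filtration G m Gs \<and>
           (\<exists>p. Gs 0 = SGraph {p} {}) \<and>
           (\<forall>k<m. proper_subgraph (Gs k) (Gs (k + 1))) \<and>
           Gs m = G"
proof -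
  obtain b where inj: "inj_on b {0..m}" and sub: "b ` {0..m} \<subseteq> verts G"
    and steps: "\<forall>k<m. greedy_step G b k"
    using greedy_prefix_exists[OF assms(1,3,5) order_refl] by blast
  have all: "b ` {0..m} = verts G"
    using inj sub assms(2,5) by (intro card_subset_eq) (auto simp: card_image)
  define Gs where "Gs k = induced_subgraph G (b ` {0..k})" for k
  have verts_Gs: "verts (Gs k) = b ` {0..k}" for k
    by (simp add: Gs_def induced_subgraph_def)
  have edges_Gs: "edges (Gs k) = {e \<in> edges G. e \<subseteq> b ` {0..k}}" for k
    by (simp add: Gs_def induced_subgraph_def)
  have last: "Gs m = G"
    using all induced_subgraph_verts[OF assms(1)] by (simp add: Gs_def)
  have "is_filtration G m Gs"
    unfolding is_filtration_def
    using inj all steps last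
    by (intro exI[of _ b])
      (simp add: bij_betw_def verts_Gs edges_Gs greedy_step_def frontier_indices_def Let_def)
  moreover have "Gs 0 = SGraph {b 0} {}"
    using induced_subgraph_singleton[OF assms(1)] by (simp add: Gs_def)
  moreover have "proper_subgraph (Gs k) (Gs (k + 1))" if "k < m" for k
  proof -
    have "b (k + 1) \<notin> b ` {0..k}"
      using steps that by (simp add: greedy_step_def)
    moreover have "b ` {0..k} \<subseteq> b ` {0..k + 1}" "b (k + 1) \<in> b ` {0..k + 1}"
      by auto
    ultimately have "b ` {0..k} \<subset> b ` {0..k + 1}" by blast
    then show ?thesis
      unfolding Gs_def by (rule proper_subgraph_induced)
  qed
  ultimately show ?thesis using last by blast
qed

end
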